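(* Let $K$ be a field such that every quadratic equation $x^2+ax+b=0$ with $a,b\in K$ has a root in $K$. Let $G$ be a group with identity element $id$ and let $f:G\to K$ be a function. Then $f$ is the character of a representation $G\to SL(2,K)$ if and only if $f(id)=2$ and $f(xy)+f(x^{-1}y)=f(x)f(y)$ for all $x,y\in G$.
   Context: The character of a representation (group homomorphism) $\rho:G\to SL(2,K)$ is the function $G\to K$, $g\mapsto \operatorname{tr}\rho(g)$. The group $G$ is arbitrary (not assumed finitely generated). *)

theory Defs
  imports "HOL-Analysis.Determinants" "HOL-Algebra.Group"
begin

definition SL2 :: "('k::field^2^2) monoid" where
  "SL2 = \<lparr>carrier = {A. det A = 1}, mult = (**), one = mat 1\<rparr>"

lemma group_SL2: "group (SL2 :: ('k::field^2^2) monoid)"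
proof (rule groupI)
  fix A :: "'k^2^2"
  assume "A \<in> carrier SL2"
  then have A: "det A = 1"
    by (simp add: SL2_def)
  then have "A $ 1 $ 1 * A $ 2 $ 2 - A $ 1 $ 2 * A $ 2 $ 1 = 1"
    by (simp add: det_2)
  then have eq: "A $ 1 $ 1 * A $ 2 $ 2 = 1 + A $ 1 $ 2 * A $ 2 $ 1"
    by (simp add: algebra_simps)
  define B :: "'k^2^2" where
    "B = vector [vector [A $ 2 $ 2, - A $ 1 $ 2], vector [- A $ 2 $ 1, A $ 1 $ 1]]"
  have BA: "B ** A = mat 1"
    using eq by (simp add: B_def vec_eq_iff forall_2 matrix_matrix_mult_def sum_2 mat_def
        algebra_simps)
  moreover have "det B = 1"
    using arg_cong[OF BA, of det] A by (simp add: det_mul)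
  ultimately show "\<exists>B\<in>carrier SL2. B \<otimes>\<^bsub>SL2\<^esub> A = \<one>\<^bsub>SL2\<^esub>"
    by (auto simp: SL2_def)
qed (auto simp: SL2_def det_mul matrix_mul_assoc)

definition is_SL2_character :: "('g, 'm) monoid_scheme \<Rightarrow> ('g \<Rightarrow> 'k::field) \<Rightarrow> bool" where
  "is_SL2_character G f \<longleftrightarrow> (\<exists>\<rho> \<in> hom G SL2. \<forall>g \<in> carrier G. f g = trace (\<rho> g))"

end

theory Submission
  imports Defs
begin

text \<open>
  A character satisfies the identity because \<open>A + A\<^sup>-\<^sup>1\<close> is the scalar matrix \<open>trace A\<close> for
  \<open>A\<close> in \<open>SL(2,K)\<close>.

  Conversely, extend \<open>f\<close> linearly to the group algebra \<open>K[G]\<close>, let \<open>I\<close> be the ideal of all \<open>a\<close>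
  with \<open>f (a b) = 0\<close> for all \<open>b\<close>, and let \<open>g\<^sup>* = g\<^sup>-\<^sup>1\<close>, so that \<open>a + a\<^sup>* = f a\<close> modulo \<open>I\<close>.
  Suppose that \<open>(f x)\<^sup>2 \<noteq> 4\<close> for some \<open>x\<close> in \<open>G\<close>. The polynomial \<open>X\<^sup>2 - f x X + 1\<close> has two
  distinct roots \<open>l\<close> and \<open>m\<close> in \<open>K\<close>, and \<open>e = (x - m) / (l - m)\<close> is modulo \<open>I\<close> an idempotent
  with \<open>e\<^sup>* = 1 - e\<close> and \<open>e a e = f (e a) e\<close>. The Peirce decomposition with respect to \<open>e\<close>
  provides the matrix entries. The diagonal ones are \<open>p g = f (e g)\<close> and \<open>q g = f ((1 - e) g)\<close>;
  the product of an upper right entry, taken at \<open>g\<close>, and a lower left entry, taken at \<open>h\<close>, is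
  \<open>B g h = f (e g (1 - e) h) = p (g h) - p g p h\<close>. The form \<open>B\<close> has rank at most one
  (\<open>B_rank_one\<close>), so it factors into functions of \<open>g\<close> and of \<open>h\<close>. This gives a homomorphism with
  character \<open>p + q = f\<close>. The algebra serves as motivation only: since \<open>e\<close> is a combination of
  \<open>x\<close> and \<open>\<one>\<close>, all that is needed are identities between values of \<open>f\<close>, of which
  \<open>p_split\<close> and \<open>p_mult3\<close> are the essential ones.

  If \<open>(f x)\<^sup>2 = 4\<close> for all \<open>x\<close>, then \<open>f\<close> is the character of a representation by scalar
  matrices \<open>1\<close> and \<open>-1\<close>. No step excludes characteristic \<open>2\<close>, where this case means \<open>f = 0\<close>.
\<close>

section \<open>Characters satisfy the trace identity\<close>

lemma trace_2: "trace (A :: 'k::field^2^2) = A $ 1 $ 1 + A $ 2 $ 2"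
  by (simp add: trace_def sum_2)

lemma trace_identity_SL2:
  fixes A A' B :: "'k::field^2^2"
  assumes "det A = 1" and inverse: "A ** A' = mat 1"
  shows "trace (A ** B) + trace (A' ** B) = trace A * trace B"
proof -
  define C :: "'k^2^2" where
    "C = vector [vector [A $ 2 $ 2, - A $ 1 $ 2], vector [- A $ 2 $ 1, A $ 1 $ 1]]"
  have "A $ 1 $ 1 * A $ 2 $ 2 = 1 + A $ 1 $ 2 * A $ 2 $ 1"
    using assms(1) by (simp add: det_2 algebra_simps)
  then have "C ** A = mat 1"
    by (simp add: C_def vec_eq_iff forall_2 matrix_matrix_mult_def sum_2 mat_def algebra_simps)
  then have "A' = C"
    by (metis inverse matrix_mul_assoc matrix_mul_lid matrix_mul_rid)
  then show ?thesis
    by (simp add: C_def trace_2 matrix_matrix_mult_def sum_2 algebra_simps)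
qed

lemma SL2_character_trace_identity:
  fixes G :: "('g, 'm) monoid_scheme" (structure) and f :: "'g \<Rightarrow> 'k::field"
  assumes "group G" and "is_SL2_character G f"
  shows "f \<one> = 2"
    and "\<And>x y. \<lbrakk>x \<in> carrier G; y \<in> carrier G\<rbrakk> \<Longrightarrow> f (x \<otimes> y) + f (inv x \<otimes> y) = f x * f y"
proof -
  interpret group G by fact
  obtain \<rho> where \<rho>: "\<rho> \<in> hom G SL2" and f: "\<And>g. g \<in> carrier G \<Longrightarrow> f g = trace (\<rho> g)"
    using assms(2) unfolding is_SL2_character_def by blast
  have one: "\<rho> \<one> = mat 1"
    using hom_one[OF \<rho> is_group group_SL2] by (simp add: SL2_def)
  have mult: "\<rho> (g \<otimes> h) = \<rho> g ** \<rho> h" if "g \<in> carrier G" "h \<in> carrier G" for g h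
    using hom_mult[OF \<rho> that] by (simp add: SL2_def)
  show "f \<one> = 2"
    by (simp add: f one trace_2 mat_def)
  show "f (x \<otimes> y) + f (inv x \<otimes> y) = f x * f y" if "x \<in> carrier G" "y \<in> carrier G" for x y
  proof -
    have "det (\<rho> x) = 1"
      using hom_in_carrier[OF \<rho> that(1)] by (simp add: SL2_def)
    moreover have "\<rho> x ** \<rho> (inv x) = mat 1"
      using mult[of x "inv x"] that one by simp
    ultimately show ?thesis
      using trace_identity_SL2[of "\<rho> x" "\<rho> (inv x)" "\<rho> y"] that by (simp add: f mult)
  qed
qed

section \<open>Consequences of the trace identity\<close>

text \<open>Functions on a group that satisfy the trace identity of \<open>SL(2,K)\<close>.\<close>

locale trace_function = group G
  for G :: "('g, 'm) monoid_scheme" (structure) +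
  fixes f :: "'g \<Rightarrow> 'k::field"
  assumes f_one: "f \<one> = 2"
    and f_mult: "\<lbrakk>x \<in> carrier G; y \<in> carrier G\<rbrakk> \<Longrightarrow> f (x \<otimes> y) + f (inv x \<otimes> y) = f x * f y"
begin

lemma inv_mult_cancel [simp]:
  "\<lbrakk>x \<in> carrier G; y \<in> carrier G\<rbrakk> \<Longrightarrow> inv x \<otimes> (x \<otimes> y) = y"
  by (simp flip: m_assoc)

lemma f_inv: "x \<in> carrier G \<Longrightarrow> f (inv x) = f x"
  using f_mult[of x \<one>] by (simp add: f_one)

lemma f_commute:
  assumes "x \<in> carrier G" "y \<in> carrier G"
  shows "f (x \<otimes> y) = f (y \<otimes> x)"
proof -
  have "f (inv y \<otimes> x) = f (inv x \<otimes> y)"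
    using f_inv[of "inv x \<otimes> y"] assms by (simp add: inv_mult_group)
  moreover have "f (x \<otimes> y) + f (inv x \<otimes> y) = f (y \<otimes> x) + f (inv y \<otimes> x)"
    using assms by (simp add: f_mult mult.commute)
  ultimately show ?thesis by simp
qed

lemma f_inv_mult:
  "\<lbrakk>x \<in> carrier G; y \<in> carrier G\<rbrakk> \<Longrightarrow> f (inv x \<otimes> y) = f x * f y - f (x \<otimes> y)"
  using f_mult[of x y] by (simp add: algebra_simps)

text \<open>
  The relation \<open>a b + b a = f a b + f b a - f (a b\<^sup>-\<^sup>1)\<close>, which is the polarisation of
  \<open>a\<^sup>2 = f a a - 1\<close>, multiplied by \<open>c\<close>.
\<close>

lemma f_polarise:
  assumes [simp]: "a \<in> carrier G" "b \<in> carrier G" "c \<in> carrier G"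
  shows "f (a \<otimes> (b \<otimes> c)) + f (b \<otimes> (a \<otimes> c))
    = f a * f (b \<otimes> c) + f b * f (a \<otimes> c) - (f a * f b - f (a \<otimes> b)) * f c"
proof -
  have "f (inv a \<otimes> (b \<otimes> c)) + f (inv b \<otimes> (a \<otimes> c)) = f (inv a \<otimes> b) * f c"
    using f_mult[of "inv a \<otimes> b" c] by (simp add: inv_mult_group m_assoc)
  then show ?thesis
    by (simp add: f_inv_mult algebra_simps)
qed

lemma f_polarise_right:
  assumes [simp]: "a \<in> carrier G" "b \<in> carrier G" "c \<in> carrier G"
  shows "f (c \<otimes> (a \<otimes> b)) + f (c \<otimes> (b \<otimes> a))
    = f a * f (c \<otimes> b) + f b * f (c \<otimes> a) - (f a * f b - f (a \<otimes> b)) * f c"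
  using f_polarise[of a b c]
  by (simp add: f_commute[of c] m_assoc)

end

section \<open>Matrix coefficients from an idempotent of the group algebra\<close>

text \<open>
  The element \<open>x\<close> plays the role of a matrix with the distinct eigenvalues \<open>l\<close> and \<open>m\<close>, and
  \<open>e = (x - m) / (l - m)\<close> that of the projection onto the eigenspace for \<open>l\<close>.
\<close>

locale split_trace_function = trace_function G f
  for G :: "('g, 'm) monoid_scheme" (structure) and f :: "'g \<Rightarrow> 'k::field" +
  fixes x :: 'g and l m :: 'k
  assumes x_closed [simp]: "x \<in> carrier G"
    and sum_roots: "l + m = f x" and prod_roots: "l * m = 1" and distinct_roots: "l \<noteq> m"
begin

text \<open>The value of \<open>f\<close> at \<open>e g\<close>: the upper left matrix entry.\<close>

definition p :: "'g \<Rightarrow> 'k" where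
  "p g = (f (x \<otimes> g) - m * f g) / (l - m)"

text \<open>The value of \<open>f\<close> at \<open>(1 - e) g\<close>: the lower right matrix entry.\<close>

definition q :: "'g \<Rightarrow> 'k" where
  "q g = f g - p g"

text \<open>
  The value of \<open>f\<close> at \<open>e g (1 - e) h\<close>: the upper right entry at \<open>g\<close> times the lower left entry
  at \<open>h\<close>.
\<close>

definition B :: "'g \<Rightarrow> 'g \<Rightarrow> 'k" where
  "B g h = p (g \<otimes> h) - p g * p h"

lemma p_scaled: "(l - m) * p g = f (x \<otimes> g) - m * f g"
  using distinct_roots by (simp add: p_def)

lemma scaled_eqI: "(l - m) * s = (l - m) * t \<Longrightarrow> s = t"
  using distinct_roots by simp

text \<open>The relation of \<open>f_polarise\<close> multiplied by \<open>e\<close>, for which \<open>f e = 1\<close>.\<close>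

lemma p_polarise:
  assumes [simp]: "g \<in> carrier G" "h \<in> carrier G"
  shows "p (g \<otimes> h) + p (h \<otimes> g) = p g * f h + f g * p h - (f g * f h - f (g \<otimes> h))"
proof (rule scaled_eqI)
  have "(l - m) * (p (g \<otimes> h) + p (h \<otimes> g)) =
      f (x \<otimes> (g \<otimes> h)) + f (x \<otimes> (h \<otimes> g)) - 2 * m * f (g \<otimes> h)"
    by (simp add: p_scaled distrib_left f_commute[of h g])
  also have "\<dots> = (f (x \<otimes> g) - m * f g) * f h + f g * (f (x \<otimes> h) - m * f h)
      - (l - m) * (f g * f h - f (g \<otimes> h))"
    by (simp add: f_polarise_right algebra_simps flip: sum_roots)
  also have "\<dots> = (l - m) * (p g * f h + f g * p h - (f g * f h - f (g \<otimes> h)))"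
    by (simp add: algebra_simps flip: p_scaled)
  finally show "(l - m) * (p (g \<otimes> h) + p (h \<otimes> g)) =
    (l - m) * (p g * f h + f g * p h - (f g * f h - f (g \<otimes> h)))" .
qed

text \<open>The relation \<open>g\<^sup>2 = f g g - 1\<close> multiplied by \<open>e\<close>.\<close>

lemma p_square:
  assumes [simp]: "g \<in> carrier G"
  shows "p (g \<otimes> g) = f g * p g - 1"
proof (rule scaled_eqI)
  have 1: "f (x \<otimes> (g \<otimes> g)) = f g * f (x \<otimes> g) - f x"
    using f_mult[of g "g \<otimes> x"] by (simp add: f_commute[of x] m_assoc eq_diff_eq)
  have 2: "f (g \<otimes> g) = f g * f g - 2"
    using f_mult[of g g] by (simp add: f_one algebra_simps)
  have "(l - m) * p (g \<otimes> g) = f g * (f (x \<otimes> g) - m * f g) - (f x - 2 * m)"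
    unfolding p_scaled 1 2 by (simp add: algebra_simps)
  also have "\<dots> = (l - m) * (f g * p g - 1)"
    by (simp add: algebra_simps flip: p_scaled sum_roots)
  finally show "(l - m) * p (g \<otimes> g) = (l - m) * (f g * p g - 1)" .
qed

text \<open>The relation \<open>e g e = f (e g) e\<close> multiplied by \<open>h\<close>, with \<open>x - m\<close> for the second \<open>e\<close>.\<close>

lemma p_split:
  assumes [simp]: "g \<in> carrier G" "h \<in> carrier G"
  shows "p (g \<otimes> (x \<otimes> h)) - m * p (g \<otimes> h) = (l - m) * (p g * p h)"
proof (rule scaled_eqI)
  have 1: "f (x \<otimes> (g \<otimes> (x \<otimes> h))) = f (x \<otimes> g) * f (x \<otimes> h) - (f g * f h - f (g \<otimes> h))"
    using f_mult[of "x \<otimes> g" "x \<otimes> h"]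
    by (simp add: inv_mult_group m_assoc f_inv_mult algebra_simps)
  have 2: "f (g \<otimes> (x \<otimes> h)) + f (x \<otimes> (g \<otimes> h))
      = f g * f (x \<otimes> h) + f x * f (g \<otimes> h) - (f g * f x - f (x \<otimes> g)) * f h"
    by (simp add: f_polarise f_commute[of g x])
  \<comment> \<open>\<open>m\<close> is a root of the characteristic polynomial of \<open>x\<close>.\<close>
  have root: "1 - m * f x + m * m = 0"
    using prod_roots by (simp add: algebra_simps flip: sum_roots)
  have "(l - m) * (p (g \<otimes> (x \<otimes> h)) - m * p (g \<otimes> h))
      = (l - m) * p (g \<otimes> (x \<otimes> h)) - m * ((l - m) * p (g \<otimes> h))"
    by (simp add: algebra_simps)
  also have "\<dots>
      = f (x \<otimes> (g \<otimes> (x \<otimes> h))) - m * (f (g \<otimes> (x \<otimes> h)) + f (x \<otimes> (g \<otimes> h))) + m * m * f (g \<otimes> h)"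
    unfolding p_scaled by (simp add: algebra_simps)
  also have "\<dots> = (f (x \<otimes> g) - m * f g) * (f (x \<otimes> h) - m * f h)
      + (1 - m * f x + m * m) * (f (g \<otimes> h) - f g * f h)"
    unfolding 1 2 by (simp add: algebra_simps)
  also have "\<dots> = (l - m) * ((l - m) * (p g * p h))"
    unfolding root p_scaled[symmetric] by (simp add: algebra_simps)
  finally show "(l - m) * (p (g \<otimes> (x \<otimes> h)) - m * p (g \<otimes> h)) = (l - m) * ((l - m) * (p g * p h))" .
qed

text \<open>The relation of \<open>f_polarise\<close> multiplied by \<open>e g\<close> on the left and by \<open>h\<close> on the right.\<close>

lemma p_polarise_mid:
  assumes [simp]: "a \<in> carrier G" "b \<in> carrier G" "g \<in> carrier G" "h \<in> carrier G"
  shows "p (g \<otimes> (a \<otimes> (b \<otimes> h))) + p (g \<otimes> (b \<otimes> (a \<otimes> h)))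
    = f a * p (g \<otimes> (b \<otimes> h)) + f b * p (g \<otimes> (a \<otimes> h)) - (f a * f b - f (a \<otimes> b)) * p (g \<otimes> h)"
proof (rule scaled_eqI)
  have cyclic: "f (c \<otimes> (a \<otimes> (b \<otimes> h))) + f (c \<otimes> (b \<otimes> (a \<otimes> h)))
    = f a * f (c \<otimes> (b \<otimes> h)) + f b * f (c \<otimes> (a \<otimes> h)) - (f a * f b - f (a \<otimes> b)) * f (c \<otimes> h)"
    if [simp]: "c \<in> carrier G" for c
    using f_polarise[of a b "h \<otimes> c"] by (simp add: f_commute[of c] m_assoc)
  show "(l - m) * (p (g \<otimes> (a \<otimes> (b \<otimes> h))) + p (g \<otimes> (b \<otimes> (a \<otimes> h)))) =
    (l - m) * (f a * p (g \<otimes> (b \<otimes> h)) + f b * p (g \<otimes> (a \<otimes> h))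
      - (f a * f b - f (a \<otimes> b)) * p (g \<otimes> h))" (is "?L = ?R")
  proof -
    have "?L = (f (x \<otimes> g \<otimes> (a \<otimes> (b \<otimes> h))) + f (x \<otimes> g \<otimes> (b \<otimes> (a \<otimes> h))))
        - m * (f (g \<otimes> (a \<otimes> (b \<otimes> h))) + f (g \<otimes> (b \<otimes> (a \<otimes> h))))"
      by (simp add: p_scaled distrib_left m_assoc)
    also have "\<dots> = f a * (f (x \<otimes> (g \<otimes> (b \<otimes> h))) - m * f (g \<otimes> (b \<otimes> h)))
        + f b * (f (x \<otimes> (g \<otimes> (a \<otimes> h))) - m * f (g \<otimes> (a \<otimes> h)))
        - (f a * f b - f (a \<otimes> b)) * (f (x \<otimes> (g \<otimes> h)) - m * f (g \<otimes> h))"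
      by (subst cyclic, simp, subst cyclic, simp) (simp add: m_assoc algebra_simps)
    also have "\<dots> = ?R"
      unfolding p_scaled[symmetric] by (simp add: algebra_simps)
    finally show ?thesis .
  qed
qed

text \<open>
  The relation \<open>(1 - e) h (1 - e) = q h (1 - e)\<close>, multiplied by \<open>e g\<close> on the left and by \<open>k\<close> on
  the right and expanded.
\<close>

lemma p_mult3:
  assumes [simp]: "g \<in> carrier G" "h \<in> carrier G" "k \<in> carrier G"
  shows "p (g \<otimes> (h \<otimes> k))
    = p (g \<otimes> h) * p k + p g * p (h \<otimes> k) + p (g \<otimes> k) * q h - p g * p k * f h"
proof (rule scaled_eqI)
  have 1: "(l - m) * (p (g \<otimes> h) * p k) = p (g \<otimes> (h \<otimes> (x \<otimes> k))) - m * p (g \<otimes> (h \<otimes> k))"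
    using p_split[of "g \<otimes> h" k] by (simp add: m_assoc)
  have 2: "(l - m) * (p g * p (h \<otimes> k)) = p (g \<otimes> (x \<otimes> (h \<otimes> k))) - m * p (g \<otimes> (h \<otimes> k))"
    by (simp add: p_split)
  have 3: "(l - m) * (p g * p k) = p (g \<otimes> (x \<otimes> k)) - m * p (g \<otimes> k)"
    by (simp add: p_split)
  have 4: "(l - m) * q h = (l - m) * f h - (f (h \<otimes> x) - m * f h)"
    by (simp add: q_def right_diff_distrib p_scaled f_commute[of h x])
  have "(l - m) * (p (g \<otimes> h) * p k + p g * p (h \<otimes> k) + p (g \<otimes> k) * q h - p g * p k * f h)
    = (l - m) * (p (g \<otimes> h) * p k) + (l - m) * (p g * p (h \<otimes> k))
      + p (g \<otimes> k) * ((l - m) * q h) - (l - m) * (p g * p k) * f h"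
    by (simp add: algebra_simps)
  also have "\<dots> = (p (g \<otimes> (h \<otimes> (x \<otimes> k))) + p (g \<otimes> (x \<otimes> (h \<otimes> k)))) - 2 * m * p (g \<otimes> (h \<otimes> k))
      + p (g \<otimes> k) * ((l - m) * f h - (f (h \<otimes> x) - m * f h))
      - (p (g \<otimes> (x \<otimes> k)) - m * p (g \<otimes> k)) * f h"
    unfolding 1 2 3 4 by (simp add: algebra_simps)
  also have "\<dots> = (l - m) * p (g \<otimes> (h \<otimes> k))"
    by (simp add: p_polarise_mid algebra_simps flip: sum_roots)
  finally show "(l - m) * p (g \<otimes> (h \<otimes> k)) = (l - m) *
    (p (g \<otimes> h) * p k + p g * p (h \<otimes> k) + p (g \<otimes> k) * q h - p g * p k * f h)"
    by (rule sym)
qed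

lemma p_mult: "p (g \<otimes> h) = p g * p h + B g h"
  by (simp add: B_def)

lemma q_mult:
  assumes "g \<in> carrier G" "h \<in> carrier G"
  shows "q (g \<otimes> h) = q g * q h + B h g"
  using p_polarise[OF assms] by (simp add: q_def B_def algebra_simps)

lemma B_mult_left:
  assumes "g \<in> carrier G" "h \<in> carrier G" "k \<in> carrier G"
  shows "B (g \<otimes> h) k = p g * B h k + B g k * q h"
  using p_mult3[OF assms] assms by (simp add: B_def q_def m_assoc algebra_simps)

lemma B_mult_right:
  assumes "g \<in> carrier G" "h \<in> carrier G" "k \<in> carrier G"
  shows "B g (h \<otimes> k) = B g h * p k + q h * B g k"
  using p_mult3[OF assms] by (simp add: B_def q_def algebra_simps)

lemma B_rank_one:
  assumes [simp]: "g \<in> carrier G" "h \<in> carrier G" "g' \<in> carrier G" "h' \<in> carrier G"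
  shows "B g h * B g' h' = B g h' * B g' h"
proof -
  \<comment> \<open>Expand \<open>B (g h g') h'\<close> along the two bracketings of the product.\<close>
  have "B (g \<otimes> (h \<otimes> g')) h' = B ((g \<otimes> h) \<otimes> g') h'"
    by (simp add: m_assoc)
  then show ?thesis
    by (simp add: B_mult_left[of g "h \<otimes> g'"] B_mult_left[of "g \<otimes> h" g']
        B_mult_left[of h g'] B_mult_left[of g h] p_mult q_mult algebra_simps)
qed

lemma det_entries:
  assumes "g \<in> carrier G"
  shows "p g * q g - B g g = 1"
  using p_square[OF assms] by (simp add: B_def q_def algebra_simps)

text \<open>
  The rank one form \<open>B\<close> factors as \<open>B g h = (B g h\<^sub>0 / B g\<^sub>0 h\<^sub>0) * B g\<^sub>0 h\<close>, and the factors are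
  the off-diagonal matrix entries.
\<close>

lemma split_is_SL2_character: "is_SL2_character G f"
proof -
  obtain g0 h0 where closed [simp]: "g0 \<in> carrier G" "h0 \<in> carrier G"
    and nonzero: "\<And>g h. \<lbrakk>g \<in> carrier G; h \<in> carrier G; B g h \<noteq> 0\<rbrakk> \<Longrightarrow> B g0 h0 \<noteq> 0"
    by (metis one_closed)
  \<comment> \<open>If \<open>B\<close> vanishes, division by zero makes \<open>u\<close> vanish too, and the representation is diagonal.\<close>
  define u where "u g = B g h0 / B g0 h0" for g
  have factor: "u g * B g0 h = B g h" if "g \<in> carrier G" "h \<in> carrier G" for g h
  proof (cases "B g0 h0 = 0")
    case True
    then show ?thesis using nonzero that by (auto simp: u_def)
  next
    case False
    then show ?thesis using B_rank_one[of g h g0 h0] that by (simp add: u_def divide_simps)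
  qed
  have u_mult: "u (g \<otimes> h) = p g * u h + u g * q h" if "g \<in> carrier G" "h \<in> carrier G" for g h
    using that by (simp add: u_def B_mult_left add_divide_distrib)
  define \<rho> :: "'g \<Rightarrow> 'k^2^2" where "\<rho> g = vector [vector [p g, u g], vector [B g0 g, q g]]" for g
  have "\<rho> \<in> hom G SL2"
  proof (rule homI)
    fix g assume g: "g \<in> carrier G"
    show "\<rho> g \<in> carrier SL2"
      using det_entries[OF g] factor[OF g g] by (simp add: SL2_def \<rho>_def det_2)
  next
    fix g h assume gh: "g \<in> carrier G" "h \<in> carrier G"
    have "q (g \<otimes> h) = B g0 g * u h + q g * q h"
      using q_mult[OF gh] factor[of h g] gh by (simp add: mult.commute)
    moreover have "p (g \<otimes> h) = p g * p h + u g * B g0 h"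
      using gh by (simp add: factor p_mult)
    ultimately show "\<rho> (g \<otimes> h) = \<rho> g \<otimes>\<^bsub>SL2\<^esub> \<rho> h"
      using u_mult[OF gh] B_mult_right[of g0 g h] gh
      by (simp add: SL2_def \<rho>_def vec_eq_iff forall_2 matrix_matrix_mult_def sum_2)
  qed
  moreover have "f g = trace (\<rho> g)" for g
    by (simp add: \<rho>_def trace_2 q_def)
  ultimately show ?thesis
    unfolding is_SL2_character_def by blast
qed

end

section \<open>Scalar representations\<close>

context trace_function
begin

lemma scalar_is_SL2_character:
  assumes hom: "\<And>g h. \<lbrakk>g \<in> carrier G; h \<in> carrier G\<rbrakk> \<Longrightarrow> c (g \<otimes> h) = c g * c h"
    and square: "\<And>g. g \<in> carrier G \<Longrightarrow> c g * c g = 1"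
    and f: "\<And>g. g \<in> carrier G \<Longrightarrow> f g = 2 * c g"
  shows "is_SL2_character G f"
proof -
  have "(\<lambda>g. mat (c g) :: 'k^2^2) \<in> hom G SL2"
    by (rule homI)
      (auto simp: SL2_def det_2 mat_def square hom vec_eq_iff forall_2 matrix_matrix_mult_def sum_2)
  moreover have "f g = trace (mat (c g) :: 'k^2^2)" if "g \<in> carrier G" for g
    using f[OF that] by (simp add: trace_2 mat_def)
  ultimately show ?thesis
    unfolding is_SL2_character_def by (intro bexI[of _ "\<lambda>g. mat (c g)"] ballI)
qed

lemma square_eq_4_is_SL2_character:
  assumes "\<And>g. g \<in> carrier G \<Longrightarrow> (f g)\<^sup>2 = 4"
  shows "is_SL2_character G f"
proof (cases "(2 :: 'k) = 0")
  case True
  have "(4 :: 'k) = 2 * 2" by simp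
  also have "\<dots> = 0" using True by simp
  finally have "f g = 0" if "g \<in> carrier G" for g
    using assms[OF that] by simp
  then show ?thesis
    using True by (intro scalar_is_SL2_character[of "\<lambda>_. 1"]) auto
next
  case False
  define c where "c g = f g / 2" for g
  have f: "f g = 2 * c g" for g
    using False by (simp add: c_def)
  have sq: "(c g)\<^sup>2 = 1" if "g \<in> carrier G" for g
  proof -
    have "(2 * 2) * (c g)\<^sup>2 = (2 * 2) * 1"
      using assms[OF that] by (simp add: f power_mult_distrib)
    then show ?thesis
      using False by (metis mult_cancel_left mult_eq_0_iff)
  qed
  have sign: "c g = 1 \<or> c g = -1" if "g \<in> carrier G" for g
    using sq[OF that] by (simp add: power2_eq_1_iff)
  have "c (g \<otimes> h) = c g * c h" if gh: "g \<in> carrier G" "h \<in> carrier G" for g h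
  proof -
    have "2 * (c (g \<otimes> h) + c (inv g \<otimes> h)) = 2 * (2 * (c g * c h))"
      using f_mult[OF gh] by (simp add: f algebra_simps)
    then have sum: "c (g \<otimes> h) + c (inv g \<otimes> h) = 2 * (c g * c h)"
      using False by (metis mult_cancel_left)
    \<comment> \<open>If the two signs on the left were not both equal to \<open>c g * c h\<close>, then \<open>2\<close> would vanish.\<close>
    define s where "s = c g * c h"
    have "s = 1 \<or> s = -1"
      using sign[OF gh(1)] sign[OF gh(2)] by (auto simp: s_def)
    then have "s \<noteq> 0"
      by auto
    with False have "2 * s \<noteq> 0" "2 * (2 * s) \<noteq> 0"
      by (simp_all only: mult_eq_0_iff simp_thms)
    moreover have "c (inv g \<otimes> h) = s \<or> c (inv g \<otimes> h) = - s"
        and "c (g \<otimes> h) = s \<or> c (g \<otimes> h) = - s"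
      using sign[of "inv g \<otimes> h"] sign[of "g \<otimes> h"] gh \<open>s = 1 \<or> s = -1\<close> by auto
    moreover have "c (g \<otimes> h) + c (inv g \<otimes> h) = 2 * s"
      using sum by (simp add: s_def)
    moreover have "2 * s = (2 * s - (- s)) - s" "2 * (2 * s) = (2 * s - (- s)) - (- s)"
      by (simp_all add: algebra_simps)
    ultimately show "c (g \<otimes> h) = c g * c h"
      unfolding s_def[symmetric] by (metis add_diff_cancel_left' right_minus_eq)
  qed
  then show ?thesis
    using sq f by (intro scalar_is_SL2_character[of c]) (auto simp: power2_eq_square)
qed

end

section \<open>Characterisation of characters\<close>

theorem corollary1p1:
  fixes G :: "('g, 'm) monoid_scheme" (structure)
    and f :: "'g \<Rightarrow> 'k::field"
  assumes "\<forall>a b :: 'k. \<exists>x. x\<^sup>2 + a * x + b = 0"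
    and "group G"
  shows "is_SL2_character G f \<longleftrightarrow>
    f \<one> = 2 \<and>
    (\<forall>x \<in> carrier G. \<forall>y \<in> carrier G. f (x \<otimes> y) + f (inv x \<otimes> y) = f x * f y)"
proof
  assume "is_SL2_character G f"
  note identity = SL2_character_trace_identity[OF assms(2) this]
  show "f \<one> = 2 \<and>
      (\<forall>x \<in> carrier G. \<forall>y \<in> carrier G. f (x \<otimes> y) + f (inv x \<otimes> y) = f x * f y)"
    by (intro conjI ballI identity)
next
  assume identity: "f \<one> = 2 \<and>
    (\<forall>x \<in> carrier G. \<forall>y \<in> carrier G. f (x \<otimes> y) + f (inv x \<otimes> y) = f x * f y)"
  interpret group G by fact
  interpret trace_function G f
    by unfold_locales (use identity in auto)
  show "is_SL2_character G f"
  proof (cases "\<forall>g \<in> carrier G. (f g)\<^sup>2 = 4")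
    case True
    then show ?thesis
      using square_eq_4_is_SL2_character by blast
  next
    case False
    then obtain x where x: "x \<in> carrier G" "(f x)\<^sup>2 \<noteq> 4"
      by blast
    obtain l where l: "l\<^sup>2 + (- f x) * l + 1 = 0"
      using assms(1) by blast
    have prod: "l * (f x - l) = 1"
      using l by (simp add: power2_eq_square algebra_simps)
    have "l \<noteq> f x - l"
    proof
      assume "l = f x - l"
      with prod have "f x = 2 * l" and "l * l = 1"
        by (auto simp: algebra_simps)
      then show False
        using x(2) by (simp add: power2_eq_square)
    qed
    with x prod interpret split_trace_function G f x l "f x - l"
      by unfold_locales auto
    show ?thesis
      by (rule split_is_SL2_character)
  qed
qed

end
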